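(* For the general Christoffel transformation of $\vec w=(w_1,w_2)$ by the polynomial $\tilde P(x)=p(x^2)P(x)$ of degree $\tilde N=2M+N$, let $\tau_n$ be the $\tilde N\times\tilde N$ determinant $$\tau_n=\det\begin{bmatrix}R_n\\ R_{n+1}\\ \vdots\\ R_{n+\tilde N-1}\end{bmatrix},\qquad R_l=\big(v_1^{(l)}(r_1^2),\dots,v_1^{(l)}(r_M^2),\,v_2^{(l)}(r_1^2),\dots,v_2^{(l)}(r_M^2),\,v_2^{(l)}(x_1^2),\dots,v_2^{(l)}(x_N^2)\big).$$ Then $\tau_n\neq0$ for all $n\ge\tilde N$.
   Context: Let $\Delta\subset\mathbb R$ be an interval, $\mu$ a measure supported on $\Delta$, and $w_1,w_2$ weight functions on $\Delta$ with all moments finite. All vectors and matrices are semi-infinite, indexed by $0,1,2,\dots$. Put $X(x)=(1,x,x^2,\dots)^\top$, $X_1(x)=(1,0,x,0,x^2,0,\dots)^\top$, $X_2(x)=(0,1,0,x,0,x^2,\dots)^\top$. For a pair of weights $\vec u=(u_1,u_2)$, $g_{\vec u}=\int_\Delta X\big(X_1u_1+X_2u_2\big)^\top\mathrm d\mu$. Perturbing polynomial: $P(x)=(x-x_1)\cdots(x-x_N)\in\mathbb R[x]$ is monic and non-symmetric (if $x_0\neq0$ is a root, then $-x_0$ is not), $p(x)=(x-r_1^2)\cdots(x-r_M^2)\in\mathbb R[x]$, $\tilde P(x)=p(x^2)P(x)$, $\tilde N=2M+N$. Write $P(x)=P_{\mathrm e}(x^2)+xP_{\mathrm o}(x^2)$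 with polynomials $P_{\mathrm e},P_{\mathrm o}$, and $\pi(x)=P_{\mathrm e}(x)^2-xP_{\mathrm o}(x)^2$, whose zeros are $x_1^2,\dots,x_N^2$. It is assumed that the zeros $r_1^2,\dots,r_M^2,x_1^2,\dots,x_N^2$ of $p\pi$ are pairwise distinct. Perturbed weights: $\hat{\vec w}=(\hat w_1,\hat w_2)$ with $\hat w_1=p(P_{\mathrm e}w_1+P_{\mathrm o}w_2)$, $\hat w_2=p(xP_{\mathrm o}w_1+P_{\mathrm e}w_2)$. It is assumed that both $g_{\vec w}$ and $g_{\hat{\vec w}}$ have Gauss–Borel factorizations $g_{\vec w}=S^{-1}H\tilde S^{-\top}$, $g_{\hat{\vec w}}=\hat S^{-1}\hat H\hat{\tilde S}^{-\top}$, with lower unitriangular $S,\tilde S,\hat S,\hat{\tilde S}$ and diagonal $H,\hat H$ with nonzero entries. $A_a^{(n)}$ denotes the $n$-th entry of $A_a=H^{-1}\tilde SX_a$, $a\in\{1,2\}$, and $$v_1^{(n)}(x)=P_{\mathrm e}(x)A_1^{(n)}(x)-xP_{\mathrm o}(x)A_2^{(n)}(x),\qquad v_2^{(n)}(x)=-P_{\mathrm o}(x)A_1^{(n)}(x)+P_{\mathrm e}(x)A_2^{(n)}(x).$$ *)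

theory Defs
  imports
    "HOL-Analysis.Set_Integral"
    "HOL-Library.Groups_Big_Fun"
    "HOL-Computational_Algebra.Polynomial"
    "Jordan_Normal_Form.Determinant"
begin

type_synonym smat = "nat \<Rightarrow> nat \<Rightarrow> real"

(* Sum_any is the finite sum over the support (and 0 if the support is infinite). Below,
   products always have a lower triangular or diagonal left factor, so the sums are finite. *)
definition smat_mult :: "smat \<Rightarrow> smat \<Rightarrow> smat"  (infixl "\<odot>" 70)
  where "A \<odot> B = (\<lambda>i j. Sum_any (\<lambda>k. A i k * B k j))"

definition smat_vec :: "smat \<Rightarrow> (nat \<Rightarrow> 'a) \<Rightarrow> nat \<Rightarrow> ('a :: real_field)"
  where "smat_vec A v = (\<lambda>i. Sum_any (\<lambda>k. of_real (A i k) * v k))"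

definition smat_diag :: "(nat \<Rightarrow> real) \<Rightarrow> smat"
  where "smat_diag h = (\<lambda>i j. if i = j then h i else 0)"

definition smat_transpose :: "smat \<Rightarrow> smat"
  where "smat_transpose A = (\<lambda>i j. A j i)"

definition lower_unitriangular :: "smat \<Rightarrow> bool"
  where "lower_unitriangular A \<longleftrightarrow> (\<forall>i. A i i = 1) \<and> (\<forall>i j. i < j \<longrightarrow> A i j = 0)"

(* T is the inverse of S in the group of lower unitriangular matrices. *)
definition unitriangular_inverse :: "smat \<Rightarrow> smat \<Rightarrow> bool"
  where "unitriangular_inverse S T \<longleftrightarrow>
    lower_unitriangular S \<and> lower_unitriangular T \<and>
    S \<odot> T = smat_diag (\<lambda>_. 1) \<and> T \<odot> S = smat_diag (\<lambda>_. 1)"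

(* g = S^{-1} H St^{-T} with H = diag(h(0), h(1), ...); L and Lt are the inverses of S and St. *)
definition gauss_borel :: "smat \<Rightarrow> smat \<Rightarrow> (nat \<Rightarrow> real) \<Rightarrow> smat \<Rightarrow> bool"
  where "gauss_borel g S h St \<longleftrightarrow>
    lower_unitriangular S \<and> lower_unitriangular St \<and> (\<forall>n. h n \<noteq> 0) \<and>
    (\<exists>L Lt. unitriangular_inverse S L \<and> unitriangular_inverse St Lt \<and>
       g = L \<odot> smat_diag h \<odot> smat_transpose Lt)"

definition vecX :: "'a \<Rightarrow> nat \<Rightarrow> ('a :: real_field)"
  where "vecX x n = x ^ n"

definition vecX1 :: "'a \<Rightarrow> nat \<Rightarrow> ('a :: real_field)"
  where "vecX1 x n = (if even n then x ^ (n div 2) else 0)"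

definition vecX2 :: "'a \<Rightarrow> nat \<Rightarrow> ('a :: real_field)"
  where "vecX2 x n = (if odd n then x ^ (n div 2) else 0)"

definition moment_matrix ::
    "real set \<Rightarrow> real measure \<Rightarrow> (real \<Rightarrow> real) \<Rightarrow> (real \<Rightarrow> real) \<Rightarrow> smat"
  where "moment_matrix \<Delta> \<mu> u1 u2 = (\<lambda>i j.
    set_lebesgue_integral \<mu> \<Delta> (\<lambda>x. vecX x i * (vecX1 x j * u1 x + vecX2 x j * u2 x)))"

definition finite_moments :: "real set \<Rightarrow> real measure \<Rightarrow> (real \<Rightarrow> real) \<Rightarrow> bool"
  where "finite_moments \<Delta> \<mu> w \<longleftrightarrow> (\<forall>n::nat. set_integrable \<mu> \<Delta> (\<lambda>x. x ^ n * w x))"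

(* Polynomials with real coefficients are evaluated at complex points, because the zeros of a
   real polynomial need not be real. *)
abbreviation cpoly :: "real poly \<Rightarrow> complex poly"
  where "cpoly \<equiv> map_poly complex_of_real"

definition A1 :: "(nat \<Rightarrow> real) \<Rightarrow> smat \<Rightarrow> nat \<Rightarrow> complex \<Rightarrow> complex"
  where "A1 h St n x = smat_vec (smat_diag (\<lambda>k. inverse (h k)) \<odot> St) (vecX1 x) n"

definition A2 :: "(nat \<Rightarrow> real) \<Rightarrow> smat \<Rightarrow> nat \<Rightarrow> complex \<Rightarrow> complex"
  where "A2 h St n x = smat_vec (smat_diag (\<lambda>k. inverse (h k)) \<odot> St) (vecX2 x) n"

definition v1 ::
    "real poly \<Rightarrow> real poly \<Rightarrow> (nat \<Rightarrow> real) \<Rightarrow> smat \<Rightarrow> nat \<Rightarrow> complex \<Rightarrow> complex"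
  where "v1 Pe Po h St n x =
    poly (cpoly Pe) x * A1 h St n x - x * poly (cpoly Po) x * A2 h St n x"

definition v2 ::
    "real poly \<Rightarrow> real poly \<Rightarrow> (nat \<Rightarrow> real) \<Rightarrow> smat \<Rightarrow> nat \<Rightarrow> complex \<Rightarrow> complex"
  where "v2 Pe Po h St n x =
    - poly (cpoly Po) x * A1 h St n x + poly (cpoly Pe) x * A2 h St n x"

definition tau_row ::
    "real poly \<Rightarrow> real poly \<Rightarrow> (nat \<Rightarrow> real) \<Rightarrow> smat \<Rightarrow> complex list \<Rightarrow> complex list \<Rightarrow>
     nat \<Rightarrow> complex list"
  where "tau_row Pe Po h St rs xs l =
    map (\<lambda>r. v1 Pe Po h St l (r\<^sup>2)) rs @ map (\<lambda>r. v2 Pe Po h St l (r\<^sup>2)) rs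
      @ map (\<lambda>x. v2 Pe Po h St l (x\<^sup>2)) xs"

definition tau ::
    "real poly \<Rightarrow> real poly \<Rightarrow> (nat \<Rightarrow> real) \<Rightarrow> smat \<Rightarrow> complex list \<Rightarrow> complex list \<Rightarrow>
     nat \<Rightarrow> complex"
  where "tau Pe Po h St rs xs n =
    (let Nt = 2 * length rs + length xs
     in Determinant.det (mat_of_rows_list Nt (map (tau_row Pe Po h St rs xs) [n..<n + Nt])))"

end

theory Submission
  imports
    Defs
    "HOL-Computational_Algebra.Field_as_Ring"
    "Jordan_Normal_Form.Char_Poly"
begin

text \<open>
  A pair \<open>(f\<^sub>1, f\<^sub>2)\<close> of polynomials is encoded as the single polynomial
  \<open>f\<^sub>1(t\<^sup>2) + t f\<^sub>2(t\<^sup>2)\<close>. Passing from \<open>w\<close> to the perturbed weights then becomes multiplication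
  by \<open>Pt\<close>, the \<open>n\<close>-th entries of \<open>A\<^sub>1\<close>, \<open>A\<^sub>2\<close> become a polynomial \<open>a\<^sub>n\<close> of exact degree \<open>n\<close>
  orthogonal to \<open>x\<^sup>i\<close> for \<open>i < n\<close>, and \<open>v\<^sub>1\<close>, \<open>v\<^sub>2\<close> become the even and odd parts of \<open>P(-t) a\<^sub>n(t)\<close>.
  If \<open>tau = 0\<close>, some nontrivial combination \<open>u\<close> of \<open>a\<^sub>n, \<dots>, a\<^bsub>n + Nt - 1\<^esub>\<close> is such that the odd part of
  \<open>P(-t) u(t)\<close> vanishes at all \<open>r\<^sup>2\<close> and \<open>x\<^sup>2\<close> and the even part at all \<open>r\<^sup>2\<close>; this forces
  \<open>u = Pt f\<close>. Then \<open>f\<close> has degree less than \<open>n\<close> and is orthogonal to \<open>x\<^sup>i\<close>, \<open>i < n\<close>, for the perturbed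
  weights, so \<open>f = 0\<close> because the leading principal minors of the perturbed moment matrix
  do not vanish. This contradicts \<open>u \<noteq> 0\<close>.
\<close>

section \<open>Polynomials paired with sequences\<close>

text \<open>One notion covers evaluation and integration: the functional sending \<open>t^i\<close>
  to \<open>b i\<close> extracts the even or odd part when \<open>b\<close> is
  \<open>vecX1 x\<close> or \<open>vecX2 x\<close>, and integrates against the weights when
  \<open>b\<close> is a row of a moment matrix.\<close>

definition pairing :: "'a::comm_semiring_0 poly \<Rightarrow> (nat \<Rightarrow> 'a) \<Rightarrow> 'a"
  where "pairing f b = (\<Sum>i\<le>degree f. coeff f i * b i)"

abbreviation even_val :: "'a::real_field poly \<Rightarrow> 'a \<Rightarrow> 'a"
  where "even_val f x \<equiv> pairing f (vecX1 x)"

abbreviation odd_val :: "'a::real_field poly \<Rightarrow> 'a \<Rightarrow> 'a"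
  where "odd_val f x \<equiv> pairing f (vecX2 x)"

lemma pairing_eq_sum_lessThan:
  assumes "\<And>i. i \<ge> m \<Longrightarrow> coeff f i = 0"
  shows "pairing f b = (\<Sum>i<m. coeff f i * b i)"
proof -
  have "pairing f b = (\<Sum>i\<in>{..degree f} \<union> {..<m}. coeff f i * b i)"
    unfolding pairing_def by (intro sum.mono_neutral_left) (auto simp: coeff_eq_0)
  also have "\<dots> = (\<Sum>i<m. coeff f i * b i)"
    using assms by (intro sum.mono_neutral_right) auto
  finally show ?thesis .
qed

lemma pairing_0 [simp]: "pairing 0 b = 0"
  by (simp add: pairing_def)

lemma pairing_pCons [simp]: "pairing (pCons a f) b = a * b 0 + pairing f (\<lambda>i. b (Suc i))"
proof -
  have "pairing (pCons a f) b = (\<Sum>i<Suc (Suc (degree f)). coeff (pCons a f) i * b i)"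
    by (rule pairing_eq_sum_lessThan) (auto simp: coeff_pCons coeff_eq_0 split: nat.split)
  also have "\<dots> = a * b 0 + (\<Sum>i<Suc (degree f). coeff f i * b (Suc i))"
    by (subst sum.lessThan_Suc_shift) simp
  finally show ?thesis
    by (simp add: pairing_def lessThan_Suc_atMost)
qed

lemma pairing_add: "pairing (f + g) b = pairing f b + pairing g b"
proof -
  let ?m = "Suc (max (degree f) (degree g))"
  have "pairing q b = (\<Sum>i<?m. coeff q i * b i)" if "q \<in> {f, g, f + g}" for q
    using that by (intro pairing_eq_sum_lessThan) (auto simp: coeff_eq_0)
  then show ?thesis
    by (simp add: distrib_right sum.distrib del: sum.lessThan_Suc)
qed

lemma pairing_smult: "pairing (Polynomial.smult c f) b = c * pairing f b"
  by (induction f arbitrary: b) (auto simp: algebra_simps)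

lemma pairing_sum: "pairing (\<Sum>i\<in>A. f i) b = (\<Sum>i\<in>A. pairing (f i) b)"
  by (induction A rule: infinite_finite_induct) (auto simp: pairing_add)

lemma pairing_add_right: "pairing f (\<lambda>i. b i + c i) = pairing f b + pairing f c"
  by (simp add: pairing_def sum.distrib distrib_left)

lemma pairing_mult_right: "pairing f (\<lambda>i. c * b i) = c * pairing f b"
  by (simp add: pairing_def sum_distrib_left mult.left_commute)

text \<open>Multiplication by \<open>g\<close> is adjoint to a combination of shifts of the
  sequence. This later moves \<open>Pt\<close> from the polynomial to the moments.\<close>

lemma pairing_mult: "pairing (f * g) b = pairing f (\<lambda>j. pairing g (\<lambda>k. b (k + j)))"
  by (induction f arbitrary: b) (simp_all add: pairing_add pairing_smult)

lemma pairing_monom: "pairing (monom c j) b = c * b j"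
  by (induction j arbitrary: b) (simp_all add: monom_0 monom_Suc)

lemma pairing_cpoly: "pairing (cpoly f) (\<lambda>i. complex_of_real (b i)) = of_real (pairing f b)"
  by (simp add: pairing_def of_real_hom.degree_map_poly_hom)

section \<open>Even and odd parts\<close>

lemma vecX1_Suc: "(\<lambda>i. vecX1 x (Suc i)) = (\<lambda>i. x * vecX2 x i)"
  by (auto simp: vecX1_def vecX2_def elim!: oddE)

lemma vecX2_Suc: "(\<lambda>i. vecX2 x (Suc i)) = vecX1 x"
  by (auto simp: vecX1_def vecX2_def elim!: evenE)

lemma even_val_pCons [simp]: "even_val (pCons a f) x = a + x * odd_val f x"
  by (subst pairing_pCons) (simp only: vecX1_Suc pairing_mult_right, simp add: vecX1_def)

lemma odd_val_pCons [simp]: "odd_val (pCons a f) x = even_val f x"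
  by (subst pairing_pCons) (simp only: vecX2_Suc, simp add: vecX2_def)

text \<open>This is multiplication modulo \<open>t^2 = x\<close>: two odd parts meet in the even
  part with a factor \<open>x\<close>.\<close>

lemma
  shows even_val_mult:
      "even_val (f * g) x = even_val f x * even_val g x + x * odd_val f x * odd_val g x"
    and odd_val_mult:
      "odd_val (f * g) x = even_val f x * odd_val g x + odd_val f x * even_val g x"
  by (induction f) (simp_all add: pairing_add pairing_smult algebra_simps del: pairing_pCons)

lemma
  shows even_val_pcompose_square: "even_val (pcompose f [:0, 0, 1:]) x = poly f x"
    and odd_val_pcompose_square: "odd_val (pcompose f [:0, 0, 1:]) x = 0"
  by (induction f)
    (simp_all add: pcompose_pCons pairing_add even_val_mult odd_val_mult del: pairing_pCons mult_pCons_left)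

lemma
  shows even_val_reflect: "even_val (pcompose f [:0, - 1:]) x = even_val f x"
    and odd_val_reflect: "odd_val (pcompose f [:0, - 1:]) x = - odd_val f x"
  by (induction f)
    (simp_all add: pcompose_pCons pairing_add even_val_mult odd_val_mult del: pairing_pCons mult_pCons_left)

lemma poly_eq_even_val_odd_val: "poly f t = even_val f (t\<^sup>2) + t * odd_val f (t\<^sup>2)"
  by (induction f) (simp_all add: algebra_simps power2_eq_square del: pairing_pCons)

text \<open>The remainder of \<open>f\<close> modulo \<open>t^2 - z\<close> is
  \<open>even_val f z + t * odd_val f z\<close>.\<close>

lemma square_diff_dvd:
  fixes f :: "'a::real_field poly"
  assumes "even_val f z = 0" "odd_val f z = 0"
  shows "[:- z, 0, 1:] dvd f"
proof -
  have "\<exists>q. f = [:- z, 0, 1:] * q + [:even_val f z, odd_val f z:]"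
  proof (induction f)
    case 0
    show ?case by (intro exI[of _ 0]) simp
  next
    case (pCons a f)
    then obtain q where q: "f = [:- z, 0, 1:] * q + [:even_val f z, odd_val f z:]" by blast
    have "pCons a f = [:a:] + [:0, 1:] * f" by simp
    also have "\<dots> = [:a:] + [:0, 1:] * ([:- z, 0, 1:] * q + [:even_val f z, odd_val f z:])"
      by (subst (1) q) (rule refl)
    also have "\<dots> = [:- z, 0, 1:] * ([:0, 1:] * q + [:odd_val f z:])
        + [:a + z * odd_val f z, even_val f z:]"
      by (simp add: distrib_left)
    finally show ?case
      unfolding even_val_pCons odd_val_pCons by (rule exI)
  qed
  then obtain q where "f = [:- z, 0, 1:] * q"
    unfolding assms by (auto simp only: pCons_0_0 add_0_right)
  then show ?thesis by (rule dvdI)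
qed

section \<open>Divisibility by the perturbing polynomial\<close>

lemma coprime_poly_bezout:
  fixes f g :: "'a::{field, factorial_ring_gcd} poly"
  assumes "a * f + b * g = [:c:]" "c \<noteq> 0"
  shows "coprime f g"
proof (rule coprimeI)
  fix d assume "d dvd f" "d dvd g"
  then have "d dvd [:c:]" by (metis assms(1) dvd_add dvd_mult)
  moreover have "is_unit [:c:]" using assms(2) by (simp add: is_unit_pCons_iff)
  ultimately show "is_unit d" by (rule dvd_trans)
qed

lemma prod_list_dvd:
  fixes fs :: "'a::semiring_gcd list"
  assumes "\<And>f. f \<in> set fs \<Longrightarrow> f dvd u" "sorted_wrt coprime fs"
  shows "prod_list fs dvd u"
  using assms by (induction fs) (auto intro!: divides_mult prod_list_coprime_right)

lemma pcompose_prod_list: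
  "pcompose (\<Prod>x\<leftarrow>xs. f x) q = (\<Prod>x\<leftarrow>xs. pcompose (f x) q)"
  by (induction xs) (simp_all add: pcompose_mult pcompose_1)

lemma sorted_wrt_map_if_distinct:
  assumes "distinct (map f xs)" "\<And>x y. f x \<noteq> f y \<Longrightarrow> R (g x) (g y)"
  shows "sorted_wrt R (map g xs)"
  using assms by (induction xs) (auto simp: rev_image_eqI)

text \<open>The factors \<open>t^2 - r^2\<close> and \<open>t - x\<close> are pairwise coprime, so
  each may be treated alone. The first divides \<open>V\<close> and is coprime to
  \<open>P(-t)\<close>. For the second, \<open>t^2 - x^2\<close> divides \<open>V\<close>, while
  \<open>P(-t)\<close> accounts only for \<open>t + x\<close>.\<close>

lemma Christoffel_polynomial_dvd:
  fixes rs xs :: "complex list" and P u :: "complex poly"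
  defines "V \<equiv> pcompose P [:0, - 1:] * u"
  assumes P: "P = (\<Prod>x\<leftarrow>xs. [:- x, 1:])"
    and dist: "distinct (map (\<lambda>r. r\<^sup>2) rs @ map (\<lambda>x. x\<^sup>2) xs)"
    and r: "\<And>r. r \<in> set rs \<Longrightarrow> even_val V (r\<^sup>2) = 0 \<and> odd_val V (r\<^sup>2) = 0"
    and x: "\<And>x. x \<in> set xs \<Longrightarrow> odd_val V (x\<^sup>2) = 0"
  shows "(\<Prod>r\<leftarrow>rs. [:- (r\<^sup>2), 0, 1:]) * P dvd u"
proof -
  have reflect: "pcompose (\<Prod>x\<leftarrow>ys. [:- x, 1:]) [:0, - 1:] = (\<Prod>x\<leftarrow>ys. [:- x, - 1:])"
    for ys :: "complex list"
    by (simp add: pcompose_prod_list pcompose_pCons)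
  have "[:- (r\<^sup>2), 0, 1:] dvd u" if "r \<in> set rs" for r
  proof -
    have "coprime [:- (r\<^sup>2), 0, 1:] [:- x, - 1:]" if "x \<in> set xs" for x
    proof (rule coprime_poly_bezout)
      show "1 * [:- (r\<^sup>2), 0, 1:] + [:- x, 1:] * [:- x, - 1:] = [:x\<^sup>2 - r\<^sup>2:]"
        by (simp add: power2_eq_square)
      show "x\<^sup>2 - r\<^sup>2 \<noteq> 0"
        using dist \<open>r \<in> set rs\<close> \<open>x \<in> set xs\<close> by (auto simp: image_iff)
    qed
    then have "coprime [:- (r\<^sup>2), 0, 1:] (pcompose P [:0, - 1:])"
      unfolding P reflect by (intro prod_list_coprime_right) auto
    moreover have "[:- (r\<^sup>2), 0, 1:] dvd V"
      using r[OF that] by (intro square_diff_dvd) auto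
    ultimately show ?thesis
      unfolding V_def by (simp add: coprime_dvd_mult_right_iff)
  qed
  moreover have "[:- x, 1:] dvd u" if x_in: "x \<in> set xs" for x
  proof -
    obtain ys zs where xs: "xs = ys @ x # zs" using x_in by (meson split_list)
    define Q where "Q = (\<Prod>x\<leftarrow>ys @ zs. [:- x, - 1:])"
    have Pm: "pcompose P [:0, - 1:] = [:x, 1:] * - Q"
      unfolding P reflect by (simp add: Q_def xs right_diff_distrib)
    \<comment> \<open>\<open>- x\<close> is a zero of \<open>P(-t)\<close>, so the vanishing of the odd part of \<open>V\<close> at \<open>x\<^sup>2\<close>
      forces that of the even part.\<close>
    have "poly V (- x) = 0" by (simp add: V_def Pm)
    then have "even_val V (x\<^sup>2) = 0"
      using x[OF x_in] by (simp add: poly_eq_even_val_odd_val)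
    then have "[:- (x\<^sup>2), 0, 1:] dvd V"
      using x[OF x_in] by (intro square_diff_dvd) auto
    moreover have "[:- (x\<^sup>2), 0, 1:] = [:x, 1:] * [:- x, 1:]"
      by (simp add: power2_eq_square)
    moreover have "V = [:x, 1:] * (- Q * u)" by (simp only: V_def Pm mult.assoc)
    ultimately have "[:- x, 1:] dvd - Q * u"
      by (metis dvd_times_left_cancel_iff pCons_eq_0_iff zero_neq_one)
    then have "poly Q x * poly u x = 0"
      by (simp add: poly_eq_0_iff_dvd[symmetric] del: mult_minus_left)
    \<comment> \<open>A zero of \<open>Q\<close> at \<open>x\<close> would be another entry
      \<open>y = - x\<close> of \<open>xs\<close> (a repeated zero if \<open>x = 0\<close>), against
      the distinctness of the squares.\<close>
    moreover have "poly Q x \<noteq> 0"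
    proof -
      have "- y - x \<noteq> 0" if "y \<in> set (ys @ zs)" for y
      proof
        assume "- y - x = 0"
        then have "y = - x" by (simp add: minus_equation_iff)
        then have "y\<^sup>2 = x\<^sup>2" by simp
        then show False using dist that by (auto simp: xs image_iff)
      qed
      then show ?thesis by (auto simp: Q_def poly_prod_list prod_list_zero_iff)
    qed
    ultimately show ?thesis by (simp add: poly_eq_0_iff_dvd)
  qed
  moreover have "sorted_wrt coprime
      (map (\<lambda>r. [:- (r\<^sup>2), 0, 1:]) rs @ map (\<lambda>x. [:- x, 1:]) xs)"
  proof -
    have "coprime [:- a, 0, 1:] [:- b, 0, 1:]" if "a \<noteq> b" for a b :: complex
      by (rule coprime_poly_bezout[of "- 1" _ 1 _ "a - b"]) (use that in auto)
    moreover have "coprime [:- a, 1:] [:- b, 1:]" if "a\<^sup>2 \<noteq> b\<^sup>2" for a b :: complex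
      by (rule coprime_poly_bezout[of "- 1" _ 1 _ "a - b"]) (use that in auto)
    \<comment> \<open>Bezout identity:
      \<open>(t^2 - a^2) - (t + b) * (t - b) = b^2 - a^2\<close>.\<close>
    moreover have "coprime [:- (a\<^sup>2), 0, 1:] [:- b, 1:]" if "a\<^sup>2 \<noteq> b\<^sup>2" for a b :: complex
      by (rule coprime_poly_bezout[of 1 _ "[:- b, - 1:]" _ "b\<^sup>2 - a\<^sup>2"])
        (use that in \<open>auto simp: power2_eq_square\<close>)
    moreover have "r\<^sup>2 \<noteq> x\<^sup>2" if "r \<in> set rs" "x \<in> set xs" for r x
      using dist that by (auto simp: image_iff)
    ultimately show ?thesis
      using dist
      by (auto simp: sorted_wrt_append intro!: sorted_wrt_map_if_distinct[where f = power2])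
  qed
  ultimately have "prod_list (map (\<lambda>r. [:- (r\<^sup>2), 0, 1:]) rs @ map (\<lambda>x. [:- x, 1:]) xs) dvd u"
    by (intro prod_list_dvd) auto
  then show ?thesis by (simp add: P)
qed

section \<open>Row dependencies and semi-infinite products\<close>

text \<open>The coefficients are a kernel vector of the transpose. Columns are given as functions of
  the row label, so each yields one linear condition on the combination.\<close>

lemma det_eq_0_imp_dependent_rows:
  fixes \<phi>s :: "('b \<Rightarrow> 'a::field) list"
  assumes len: "length ls = length \<phi>s"
    and det: "Determinant.det (mat_of_rows_list (length \<phi>s) (map (\<lambda>l. map (\<lambda>\<phi>. \<phi> l) \<phi>s) ls)) = 0"
  obtains c i where "i < length ls" "c i \<noteq> 0"
    "\<And>\<phi>. \<phi> \<in> set \<phi>s \<Longrightarrow> (\<Sum>i<length ls. c i * \<phi> (ls ! i)) = 0"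
proof -
  let ?k = "length \<phi>s"
  let ?A = "mat_of_rows_list ?k (map (\<lambda>l. map (\<lambda>\<phi>. \<phi> l) \<phi>s) ls)"
  have A: "?A \<in> carrier_mat ?k ?k" using len by (auto simp: mat_of_rows_list_def)
  then have "Determinant.det (transpose_mat ?A) = 0" using det by (simp add: det_transpose)
  then obtain v where v: "v \<in> carrier_vec ?k" "v \<noteq> 0\<^sub>v ?k" "transpose_mat ?A *\<^sub>v v = 0\<^sub>v ?k"
    using det_0_iff_vec_prod_zero[of "transpose_mat ?A" ?k] A by auto
  obtain i where "i < ?k" "v $ i \<noteq> 0"
    using v(1,2) by (metis carrier_vecD eq_vecI index_zero_vec(1) index_zero_vec(2))
  moreover have "(\<Sum>i<length ls. v $ i * \<phi> (ls ! i)) = 0" if "\<phi> \<in> set \<phi>s" for \<phi>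
  proof -
    obtain j where j: "j < ?k" "\<phi> = \<phi>s ! j" using \<open>\<phi> \<in> set \<phi>s\<close> by (metis in_set_conv_nth)
    have "(transpose_mat ?A *\<^sub>v v) $ j = (\<Sum>i<?k. v $ i * \<phi> (ls ! i))"
      using j v(1) len A
      by (auto simp: scalar_prod_def mat_of_rows_list_def atLeast0LessThan mult.commute intro!: sum.cong)
    then show ?thesis using j(1) v(3) len by simp
  qed
  ultimately show thesis using that[of i "\<lambda>i. v $ i"] len by auto
qed

text \<open>Triangularity makes the support finite, so \<open>Sum_any\<close> does not fall back to
  its default 0.\<close>

lemma smat_mult_lower:
  assumes "\<And>k. i < k \<Longrightarrow> A i k = 0"
  shows "(A \<odot> B) i j = (\<Sum>k\<le>i. A i k * B k j)"
  unfolding smat_mult_def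
  by (rule Sum_any.expand_superset) (use assms in \<open>auto simp: not_le[symmetric]\<close>)

lemma smat_diag_mult: "(smat_diag h \<odot> B) i j = h i * B i j"
  by (subst smat_mult_lower) (auto simp: smat_diag_def mult_delta_left)

lemma LDU_entry:
  assumes "lower_unitriangular L"
  shows "(L \<odot> smat_diag h \<odot> smat_transpose U) i j = (\<Sum>k\<le>i. L i k * h k * U j k)"
proof -
  have L: "L i k = 0" if "i < k" for k
    using assms that by (simp add: lower_unitriangular_def)
  have diag: "(L \<odot> smat_diag h) i k = L i k * h k" for k
    by (subst smat_mult_lower) (auto simp: L smat_diag_def mult_delta_right)
  show ?thesis
    by (subst smat_mult_lower) (auto simp: L diag smat_transpose_def)
qed

section \<open>Moment matrices under the perturbation\<close>

lemma finite_moments_shift: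
  assumes "finite_moments \<Delta> \<mu> w"
  shows "set_integrable \<mu> \<Delta> (\<lambda>x. x ^ i * (vecX1 x j * w x))"
    and "set_integrable \<mu> \<Delta> (\<lambda>x. x ^ i * (vecX2 x j * w x))"
proof -
  have a: "set_integrable \<mu> \<Delta> (\<lambda>x. x ^ (i + j div 2) * w x)"
    using assms by (simp add: finite_moments_def)
  have "set_integrable \<mu> \<Delta> (\<lambda>x. 0 :: real)" by (simp add: set_integrable_def)
  with a show "set_integrable \<mu> \<Delta> (\<lambda>x. x ^ i * (vecX1 x j * w x))"
    "set_integrable \<mu> \<Delta> (\<lambda>x. x ^ i * (vecX2 x j * w x))"
    by (cases "even j"; simp add: vecX1_def vecX2_def power_add mult.assoc)+
qed

text \<open>The even and odd parts of \<open>Pt\<close> are \<open>p * Pe\<close> and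
  \<open>p * Po\<close>, so pairing \<open>t^j * Pt\<close> with the old integrands \<open>F\<close>
  gives the new integrand of column \<open>j\<close>. Finite moments allow integrating term by
  term.\<close>

lemma moment_matrix_Christoffel:
  fixes P Pe Po p :: "real poly"
  assumes fin: "finite_moments \<Delta> \<mu> w1" "finite_moments \<Delta> \<mu> w2"
    and P: "P = pcompose Pe [:0, 0, 1:] + [:0, 1:] * pcompose Po [:0, 0, 1:]"
  shows "moment_matrix \<Delta> \<mu>
      (\<lambda>x. poly p x * (poly Pe x * w1 x + poly Po x * w2 x))
      (\<lambda>x. poly p x * (x * poly Po x * w1 x + poly Pe x * w2 x)) i j =
    pairing (pcompose p [:0, 0, 1:] * P) (\<lambda>k. moment_matrix \<Delta> \<mu> w1 w2 i (k + j))"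
    (is "moment_matrix \<Delta> \<mu> ?w1h ?w2h i j = pairing ?Pt _")
proof -
  define F where "F = (\<lambda>k x. vecX1 x k * w1 x + vecX2 x k * w2 x)"
  have F: "set_integrable \<mu> \<Delta> (\<lambda>x. x ^ i * F k x)" for k
    using set_integral_add(1)[OF finite_moments_shift(1)[OF fin(1), of i k]
        finite_moments_shift(2)[OF fin(2), of i k]]
    by (simp add: F_def distrib_left)
  have pairing_F: "pairing f (\<lambda>k. F k x) = even_val f x * w1 x + odd_val f x * w2 x" for f x
    unfolding F_def by (simp add: pairing_add_right pairing_mult_right mult.commute[of _ "w1 x"]
        mult.commute[of _ "w2 x"])
  have pointwise: "vecX1 x j * ?w1h x + vecX2 x j * ?w2h x = pairing ?Pt (\<lambda>k. F (k + j) x)" for x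
  proof -
    have "pairing ?Pt (\<lambda>k. F (k + j) x) = pairing (monom 1 j * ?Pt) (\<lambda>k. F k x)"
      by (simp add: pairing_mult[of "monom 1 j"] pairing_monom)
    also have "\<dots> = vecX1 x j * ?w1h x + vecX2 x j * ?w2h x"
      by (simp add: pairing_F even_val_mult odd_val_mult pairing_monom P pairing_add
          even_val_pcompose_square odd_val_pcompose_square algebra_simps
          del: pairing_pCons mult_pCons_left)
    finally show ?thesis ..
  qed
  have "moment_matrix \<Delta> \<mu> ?w1h ?w2h i j =
      set_lebesgue_integral \<mu> \<Delta> (\<lambda>x. \<Sum>k\<le>degree ?Pt. coeff ?Pt k * (x ^ i * F (k + j) x))"
    unfolding moment_matrix_def pointwise
    by (simp add: pairing_def vecX_def sum_distrib_left mult.left_commute)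
  also have "\<dots> = (\<Sum>k\<le>degree ?Pt. coeff ?Pt k * set_lebesgue_integral \<mu> \<Delta> (\<lambda>x. x ^ i * F (k + j) x))"
    using F by (simp add: set_lebesgue_integral_def set_integrable_def sum_distrib_left
        mult.left_commute[of "indicator _ _"] Bochner_Integration.integral_sum)
  finally show ?thesis
    by (simp add: pairing_def moment_matrix_def F_def vecX_def)
qed

section \<open>Consequences of a Gauss-Borel factorization\<close>

text \<open>Multiplying \<open>g\<close> on the right by the transpose of \<open>St\<close> cancels
  \<open>Lt\<close> and leaves the lower triangular matrix \<open>L\<close> times
  \<open>smat_diag h\<close>.\<close>

lemma gauss_borel_orthogonal:
  assumes "gauss_borel g S h St" "i < n"
  shows "(\<Sum>j\<le>n. St n j * g i j) = 0"
proof -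
  obtain L Lt where L: "lower_unitriangular L" and St: "lower_unitriangular St"
    and inv: "St \<odot> Lt = smat_diag (\<lambda>_. 1)"
    and g: "g = L \<odot> smat_diag h \<odot> smat_transpose Lt"
    using assms(1) by (auto simp: gauss_borel_def unitriangular_inverse_def)
  have "(\<Sum>j\<le>n. St n j * g i j) = (\<Sum>k\<le>i. L i k * h k * (\<Sum>j\<le>n. St n j * Lt j k))"
    unfolding g LDU_entry[OF L] sum_distrib_left
    by (subst sum.swap) (simp add: algebra_simps)
  also have "\<dots> = (\<Sum>k\<le>i. L i k * h k * (St \<odot> Lt) n k)"
    using St by (simp add: smat_mult_lower lower_unitriangular_def)
  also have "\<dots> = 0"
    using \<open>i < n\<close> by (intro sum.neutral) (auto simp: inv smat_diag_def)
  finally show ?thesis .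
qed

text \<open>Forward substitution through \<open>L\<close> and \<open>h\<close> makes the first
  \<open>n\<close> entries \<open>q k\<close> vanish. Since \<open>Lt\<close> is unitriangular, the
  entry at \<open>degree f\<close> is the leading coefficient of \<open>f\<close>.\<close>

lemma gauss_borel_nondegenerate:
  fixes f :: "complex poly"
  assumes "gauss_borel g S h St"
    and deg: "f \<noteq> 0 \<Longrightarrow> degree f < n"
    and orth: "\<And>i. i < n \<Longrightarrow> pairing f (\<lambda>j. complex_of_real (g i j)) = 0"
  shows "f = 0"
proof (rule ccontr)
  assume "f \<noteq> 0"
  obtain L Lt where L: "lower_unitriangular L" and Lt: "lower_unitriangular Lt"
    and h: "\<And>k. h k \<noteq> 0"
    and g: "g = L \<odot> smat_diag h \<odot> smat_transpose Lt"
    using assms(1) by (auto simp: gauss_borel_def unitriangular_inverse_def)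
  define q where "q = (\<lambda>k. pairing f (\<lambda>j. complex_of_real (Lt j k)))"
  have g_q: "pairing f (\<lambda>j. complex_of_real (g i j)) = (\<Sum>k\<le>i. of_real (L i k * h k) * q k)" for i
    unfolding g LDU_entry[OF L] q_def pairing_def sum_distrib_left of_real_sum
    by (subst sum.swap) (simp add: algebra_simps)
  have "q i = 0" if "i < n" for i
    using that
  proof (induction i rule: less_induct)
    case (less i)
    have "0 = (\<Sum>k\<le>i. of_real (L i k * h k) * q k)"
      using orth[OF less.prems] by (simp add: g_q)
    also have "\<dots> = (\<Sum>k\<in>{i}. of_real (L i k * h k) * q k)"
      using less by (intro sum.mono_neutral_right) auto
    also have "\<dots> = of_real (h i) * q i"
      using L by (simp add: lower_unitriangular_def)
    finally show ?case using h[of i] by simp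
  qed
  moreover have "q (degree f) = (\<Sum>j\<in>{degree f}. coeff f j * of_real (Lt j (degree f)))"
    unfolding q_def pairing_def
    using Lt by (intro sum.mono_neutral_right) (auto simp: lower_unitriangular_def)
  ultimately show False
    using deg[OF \<open>f \<noteq> 0\<close>] \<open>f \<noteq> 0\<close> Lt by (simp add: lower_unitriangular_def)
qed

text \<open>The \<open>n\<close>-th entries of \<open>A\<^sub>1\<close> and \<open>A\<^sub>2\<close>, encoded as the even and odd parts of
  one polynomial \<open>A\<^sub>1(t\<^sup>2) + t A\<^sub>2(t\<^sup>2)\<close> of degree \<open>n\<close>.\<close>

definition mixed_poly :: "(nat \<Rightarrow> real) \<Rightarrow> smat \<Rightarrow> nat \<Rightarrow> complex poly"
  where "mixed_poly h St n = (\<Sum>k\<le>n. monom (of_real (inverse (h n) * St n k)) k)"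

lemma coeff_mixed_poly:
  "coeff (mixed_poly h St n) k = (if k \<le> n then of_real (inverse (h n) * St n k) else 0)"
  by (simp add: mixed_poly_def coeff_sum)

lemma pairing_mixed_poly:
  "pairing (mixed_poly h St n) b = (\<Sum>k\<le>n. of_real (inverse (h n) * St n k) * b k)"
  by (simp add: mixed_poly_def pairing_sum pairing_monom)

lemma smat_vec_mixed_poly:
  fixes v :: "nat \<Rightarrow> complex"
  assumes "lower_unitriangular St"
  shows "smat_vec (smat_diag (\<lambda>k. inverse (h k)) \<odot> St) v n = pairing (mixed_poly h St n) v"
  unfolding smat_vec_def pairing_mixed_poly smat_diag_mult
  by (rule Sum_any.expand_superset)
    (use assms in \<open>auto simp: lower_unitriangular_def not_le[symmetric]\<close>)

lemma degree_prod_list_const: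
  fixes f :: "'b \<Rightarrow> 'a::idom poly"
  assumes "\<And>x. degree (f x) = k" "\<And>x. f x \<noteq> 0"
  shows "degree (\<Prod>x\<leftarrow>xs. f x) = k * length xs"
proof (induction xs)
  case (Cons x xs)
  have "(\<Prod>x\<leftarrow>xs. f x) \<noteq> 0"
    using assms(2) by (metis ex_map_conv prod_list_zero_iff)
  with Cons show ?case by (simp add: degree_mult_eq assms)
qed simp

section \<open>Nonvanishing of the determinant \<open>tau\<close>\<close>

theorem theorem10:
  fixes \<Delta> :: "real set" and \<mu> :: "real measure"
    and w1 w2 w1h w2h :: "real \<Rightarrow> real"
    and P Pe Po p :: "real poly"
    and Pt :: "real poly" and Nt :: nat and \<pi> :: "real poly"
    and rs xs :: "complex list" and M N n :: nat
    and S St Sh Sth :: smat and h hh :: "nat \<Rightarrow> real"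
  assumes "is_interval \<Delta>"
    and "sets \<mu> = sets borel" and "AE x in \<mu>. x \<in> \<Delta>"
    and "finite_moments \<Delta> \<mu> w1" and "finite_moments \<Delta> \<mu> w2"
    and "length xs = N" and "length rs = M"
    and "cpoly P = (\<Prod>a\<leftarrow>xs. [:- a, 1:])"
    and "\<And>z. z \<noteq> 0 \<Longrightarrow> poly (cpoly P) z = 0 \<Longrightarrow> poly (cpoly P) (- z) \<noteq> 0"
    and "cpoly p = (\<Prod>r\<leftarrow>rs. [:- (r\<^sup>2), 1:])"
    and "Pt = pcompose p [:0, 0, 1:] * P" and "Nt = 2 * M + N"
    and "P = pcompose Pe [:0, 0, 1:] + [:0, 1:] * pcompose Po [:0, 0, 1:]"
    and "\<pi> = Pe\<^sup>2 - [:0, 1:] * Po\<^sup>2"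
    and "distinct (map (\<lambda>r. r\<^sup>2) rs @ map (\<lambda>x. x\<^sup>2) xs)"
    and "w1h = (\<lambda>x. poly p x * (poly Pe x * w1 x + poly Po x * w2 x))"
    and "w2h = (\<lambda>x. poly p x * (x * poly Po x * w1 x + poly Pe x * w2 x))"
    and "gauss_borel (moment_matrix \<Delta> \<mu> w1 w2) S h St"
    and "gauss_borel (moment_matrix \<Delta> \<mu> w1h w2h) Sh hh Sth"
    and "n \<ge> Nt"
  shows "tau Pe Po h St rs xs n \<noteq> 0"
proof
  assume tau: "tau Pe Po h St rs xs n = 0"
  note fin = assms(4,5) and P_roots = assms(8) and p_roots = assms(10) and Pt = assms(11)
    and P = assms(13) and dist = assms(15) and gb = assms(18) and gbh = assms(19)
  have Nt: "Nt = 2 * length rs + length xs"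
    using assms(6,7,12) by simp
  have St: "lower_unitriangular St" and h: "\<And>k. h k \<noteq> 0"
    using gb by (auto simp: gauss_borel_def)
  let ?g = "moment_matrix \<Delta> \<mu> w1 w2" and ?gh = "moment_matrix \<Delta> \<mu> w1h w2h"
  let ?Q = "pcompose (cpoly P) [:0, - 1:]"
  define a where "a = mixed_poly h St"
  have cP: "cpoly P = pcompose (cpoly Pe) [:0, 0, 1:] + [:0, 1:] * pcompose (cpoly Po) [:0, 0, 1:]"
    unfolding P by (simp add: of_real_hom.map_poly_hom_add of_real_hom.map_poly_pcompose
        of_real_hom.map_poly_pCons_hom)
  have cPt: "cpoly Pt = (\<Prod>r\<leftarrow>rs. [:- (r\<^sup>2), 0, 1:]) * cpoly P"
  proof -
    have "cpoly (f * g) = cpoly f * cpoly g" for f g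
      by (simp add: poly_eq_iff coeff_mult)
    then show ?thesis
      by (simp add: Pt of_real_hom.map_poly_pcompose p_roots pcompose_prod_list pcompose_pCons)
  qed
  have deg_Pt: "degree (cpoly Pt) = Nt"
    unfolding cPt P_roots Nt
    by (subst degree_mult_eq) (auto simp: prod_list_zero_iff degree_prod_list_const)
  \<comment> \<open>Replacing \<open>t\<close> by \<open>- t\<close> in \<open>P\<close> flips the
    sign of \<open>Po\<close>, which gives the minus signs in \<open>v1\<close> and
    \<open>v2\<close>.\<close>
  have v1: "v1 Pe Po h St l z = even_val (?Q * a l) z"
    and v2: "v2 Pe Po h St l z = odd_val (?Q * a l) z" for l z
    by (simp_all add: v1_def v2_def A1_def A2_def smat_vec_mixed_poly[OF St] a_def
        even_val_mult odd_val_mult even_val_reflect odd_val_reflect cP pairing_add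
        even_val_pcompose_square odd_val_pcompose_square del: pairing_pCons mult_pCons_left)

  define \<phi>s where "\<phi>s = map (\<lambda>r l. v1 Pe Po h St l (r\<^sup>2)) rs @
    map (\<lambda>r l. v2 Pe Po h St l (r\<^sup>2)) rs @ map (\<lambda>x l. v2 Pe Po h St l (x\<^sup>2)) xs"
  have len: "length \<phi>s = Nt" by (simp add: \<phi>s_def Nt)
  have "tau_row Pe Po h St rs xs = (\<lambda>l. map (\<lambda>\<phi>. \<phi> l) \<phi>s)"
    by (simp add: fun_eq_iff tau_row_def \<phi>s_def)
  then have "Determinant.det (mat_of_rows_list (length \<phi>s)
      (map (\<lambda>l. map (\<lambda>\<phi>. \<phi> l) \<phi>s) [n..<n + Nt])) = 0"
    using tau by (simp add: tau_def Let_def len Nt[symmetric])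
  then obtain c i where i: "i < Nt" "c i \<noteq> 0"
    and c: "\<And>\<phi>. \<phi> \<in> set \<phi>s \<Longrightarrow> (\<Sum>i<Nt. c i * \<phi> (n + i)) = 0"
    by (rule det_eq_0_imp_dependent_rows[rotated]) (auto simp: len)
  define u where "u = (\<Sum>i<Nt. Polynomial.smult (c i) (a (n + i)))"
  have Qu: "pairing (?Q * u) b = (\<Sum>i<Nt. c i * pairing (?Q * a (n + i)) b)" for b
    by (simp add: u_def sum_distrib_left pairing_sum pairing_smult)
  have "cpoly Pt dvd u"
    unfolding cPt
  proof (rule Christoffel_polynomial_dvd[OF P_roots dist])
    show "even_val (?Q * u) (r\<^sup>2) = 0 \<and> odd_val (?Q * u) (r\<^sup>2) = 0" if "r \<in> set rs" for r
      unfolding Qu v1[symmetric] v2[symmetric] using that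
      by (intro conjI c[of "\<lambda>l. v1 Pe Po h St l (r\<^sup>2)"] c[of "\<lambda>l. v2 Pe Po h St l (r\<^sup>2)"])
        (auto simp: \<phi>s_def)
    show "odd_val (?Q * u) (x\<^sup>2) = 0" if "x \<in> set xs" for x
      unfolding Qu v2[symmetric] using that
      by (intro c[of "\<lambda>l. v2 Pe Po h St l (x\<^sup>2)"]) (auto simp: \<phi>s_def)
  qed
  then obtain f where u: "u = f * cpoly Pt" by (metis dvdE mult.commute)

  have "f = 0"
  proof (rule gauss_borel_nondegenerate[OF gbh])
    assume "f \<noteq> 0"
    moreover have "cpoly Pt \<noteq> 0" using deg_Pt i(1) by auto
    ultimately have "degree u = degree f + Nt" using deg_Pt by (simp add: u degree_mult_eq)
    moreover have "degree u \<le> n + Nt - 1"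
      by (rule degree_le)
        (auto simp: u_def coeff_sum a_def coeff_mixed_poly intro!: sum.neutral)
    ultimately show "degree f < n" using i(1) by linarith
  next
    fix k assume "k < n"
    \<comment> \<open>\<open>Pt\<close> passes from the weights to \<open>f\<close>, turning
      \<open>f\<close> into \<open>u\<close>; the original orthogonality then applies since
      \<open>k < n + i\<close>.\<close>
    have "pairing f (\<lambda>j. complex_of_real (?gh k j)) = pairing u (\<lambda>j. complex_of_real (?g k j))"
      unfolding u pairing_mult
      by (simp add: assms(16,17) moment_matrix_Christoffel[OF fin P] pairing_cpoly Pt)
    also have "\<dots> = (\<Sum>i<Nt. c i * pairing (a (n + i)) (\<lambda>j. complex_of_real (?g k j)))"
      by (simp add: u_def pairing_sum pairing_smult)
    also have "\<dots> = 0"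
    proof (rule sum.neutral, rule ballI)
      fix i
      have "pairing (a (n + i)) (\<lambda>j. complex_of_real (?g k j)) =
          of_real (inverse (h (n + i)) * (\<Sum>j\<le>n + i. St (n + i) j * ?g k j))"
        by (simp add: a_def pairing_mixed_poly sum_distrib_left mult.assoc)
      then show "c i * pairing (a (n + i)) (\<lambda>j. complex_of_real (?g k j)) = 0"
        using gauss_borel_orthogonal[OF gb, of k "n + i"] \<open>k < n\<close> by simp
    qed
    finally show "pairing f (\<lambda>j. complex_of_real (?gh k j)) = 0" .
  qed

  \<comment> \<open>With \<open>m\<close> the last index of a nonzero coefficient,
    \<open>t^(n + m)\<close> occurs in \<open>u\<close> only through \<open>a (n + m)\<close>, whose
    leading coefficient is \<open>inverse (h (n + m))\<close>; hence \<open>u\<close> is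
    nonzero.\<close>
  define J where "J = {i. i < Nt \<and> c i \<noteq> 0}"
  define m where "m = Max J"
  have "finite J" "i \<in> J" using i by (auto simp: J_def)
  then have "m \<in> J" unfolding m_def by (intro Max_in) auto
  moreover have "c j = 0" if "j < Nt" "m < j" for j
  proof (rule ccontr)
    assume "c j \<noteq> 0"
    then have "j \<le> m"
      unfolding m_def using \<open>finite J\<close> that(1) by (intro Max_ge) (auto simp: J_def)
    then show False using that(2) by simp
  qed
  ultimately have "coeff u (n + m) = (\<Sum>i\<in>{m}. c i * coeff (a (n + i)) (n + m))"
    unfolding u_def coeff_sum coeff_smult
    by (intro sum.mono_neutral_right) (auto simp: J_def a_def coeff_mixed_poly)
  then have "coeff u (n + m) \<noteq> 0"
    using \<open>m \<in> J\<close> h[of "n + m"] St by (simp add: J_def a_def coeff_mixed_poly lower_unitriangular_def)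
  then show False using \<open>f = 0\<close> by (simp add: u)
qed

end
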